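(* Let $S$ be an exponential family of distributions of a random variable $r = (r_\nu, r_h)$ ($r_\nu$ visible, $r_h$ hidden) with natural coordinates $\theta = (\theta_\nu, \theta_h)$ and expectation coordinates $\eta = (\eta_\nu, \eta_h)$. Let $\mathscr{M} \subset S$ be a model manifold, let $\bar r_\nu$ be an observed value of the visible part, and let $\mathscr{D} = \{Q \in S : \eta_\nu(Q) = \bar r_\nu\}$ be the data manifold. Let $P \in \mathscr{M}$ have natural coordinates $(\theta^P_\nu, \theta^P_h)$, and let $Q^{*} \in \mathscr{D}$, with natural coordinates $(\theta^{*}_\nu, \theta^{*}_h)$ and expectation coordinates $(\bar r_\nu, \eta^{*}_h)$, be the $e$-projection of $P$ to $\mathscr{D}$. Then: (1) the hidden part of the natural parameter is invariant under the $e$-projection: $\theta^{*}_h = \theta^P_h$; (2) the conditional distribution of $r_h$ given $r_\nu$ is the same under $P$ and under $Q^{*}$: $\mathbb{P}_P(r_h \mid r_\nu) = \mathbb{P}_{Q^{*}}(r_h \mid r_\nu)$; (3) the conditional expectation of $r_h$ given $r_\nu$ is the same under $P$ and under $Q^{*}$: $\mathbb{E}_P[r_h \mid r_\nu] = \mathbb{E}_{Q^{*}}[r_h \mid r_\nu]$.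
   Context: $S$ is a regular minimal exponential family: its members have densities, with respect to a fixed dominating measure on the space of $r = (r_\nu, r_h) \in \mathbb{R}^{a}\times\mathbb{R}^{b}$, $$p(r;\theta) = \exp\left(\theta_\nu\cdot r_\nu + \theta_h\cdot r_h - \psi(\theta)\right),$$ with $\theta = (\theta_\nu,\theta_h)$ in an open natural parameter space and $\psi$ the log-normalizer. The expectation coordinates are $\eta_\nu = \mathbb{E}_\theta[r_\nu] = \partial\psi/\partial\theta_\nu$ and $\eta_h = \mathbb{E}_\theta[r_h] = \partial\psi/\partial\theta_h$; $\theta$ and $\eta$ are both global coordinate systems on $S$. The manifold $S$ carries the Fisher information metric $g$. The model manifold $\mathscr{M}$ is a submanifold of $S$. The $e$-geodesic between $p$ and $q$ is the curve $\log r(x;t) = (1-t)\log p(x) + t\log q(x) + \text{(normalizing term depending only on } t)$; in $S$ it is a straight line in the $\theta$ coordinates. A point $Q^{*}\in\mathscr{D}$ is the $e$-projection of $P$ to $\mathscr{D}$ when the $e$-geodesic connecting $P$ to $Q^{*}$ is orthogonal to $\mathscr{D}$ at $Q^{*}$ with respect to $g$; such $Q^{*}$ minimizes $KL(Q\|P)=\mathbb{E}_Q[\log (Q/P)]$ over $Q\in\mathscr{D}$. *)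

theory Defs
  imports "HOL-Probability.Probability"
begin

section \<open>Regular minimal exponential families\<close>

text \<open>
  The sample \<open>r = (r\<^sub>\<nu>, r\<^sub>h)\<close> and the natural parameter \<open>\<theta> = (\<theta>\<^sub>\<nu>, \<theta>\<^sub>h)\<close> both live in
  \<open>(real^'v) \<times> (real^'h)\<close>; the product inner product \<open>\<theta> \<bullet> r\<close> is
  \<open>\<theta>\<^sub>\<nu> \<bullet> r\<^sub>\<nu> + \<theta>\<^sub>h \<bullet> r\<^sub>h\<close>.
\<close>

definition nat_param_space :: "((real^'v) \<times> (real^'h)) measure \<Rightarrow> ((real^'v) \<times> (real^'h)) set" where
  "nat_param_space \<mu> = {\<theta>. integrable \<mu> (\<lambda>r. exp (\<theta> \<bullet> r))}"

definition log_normalizer :: "((real^'v) \<times> (real^'h)) measure \<Rightarrow> (real^'v) \<times> (real^'h) \<Rightarrow> real" where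
  "log_normalizer \<mu> \<theta> = ln (\<integral>r. exp (\<theta> \<bullet> r) \<partial>\<mu>)"

definition expfam_density ::
  "((real^'v) \<times> (real^'h)) measure \<Rightarrow> (real^'v) \<times> (real^'h) \<Rightarrow> (real^'v) \<times> (real^'h) \<Rightarrow> real" where
  "expfam_density \<mu> \<theta> r = exp (\<theta> \<bullet> r - log_normalizer \<mu> \<theta>)"

definition expfam_dist ::
  "((real^'v) \<times> (real^'h)) measure \<Rightarrow> (real^'v) \<times> (real^'h) \<Rightarrow> ((real^'v) \<times> (real^'h)) measure" where
  "expfam_dist \<mu> \<theta> = density \<mu> (\<lambda>r. ennreal (expfam_density \<mu> \<theta> r))"

text \<open>
  Regular: the natural parameter space is nonempty and open.  Minimal: the components of \<open>r\<close> satisfy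
  no nontrivial affine relation \<open>\<mu>\<close>-almost everywhere.  Sigma-finiteness of \<open>\<mu>\<close> is automatic, since
  a strictly positive function is \<open>\<mu>\<close>-integrable.
\<close>

definition regular_minimal_exp_family :: "((real^'v) \<times> (real^'h)) measure \<Rightarrow> bool" where
  "regular_minimal_exp_family \<mu> \<longleftrightarrow>
     sets \<mu> = sets borel \<and>
     nat_param_space \<mu> \<noteq> {} \<and> open (nat_param_space \<mu>) \<and>
     (\<forall>c d. (AE r in \<mu>. c \<bullet> r = d) \<longrightarrow> c = 0)"

definition exp_family :: "((real^'v) \<times> (real^'h)) measure \<Rightarrow> ((real^'v) \<times> (real^'h)) measure set" where
  "exp_family \<mu> = expfam_dist \<mu> ` nat_param_space \<mu>"

text \<open>Uniqueness of the natural coordinates of a member of the family is a consequence of minimality.\<close>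

definition natural_coord ::
  "((real^'v) \<times> (real^'h)) measure \<Rightarrow> ((real^'v) \<times> (real^'h)) measure \<Rightarrow> (real^'v) \<times> (real^'h)" where
  "natural_coord \<mu> P = (THE \<theta>. \<theta> \<in> nat_param_space \<mu> \<and> expfam_dist \<mu> \<theta> = P)"

definition expectation_coord :: "((real^'v) \<times> (real^'h)) measure \<Rightarrow> (real^'v) \<times> (real^'h)" where
  "expectation_coord P = (\<integral>r. fst r \<partial>P, \<integral>r. snd r \<partial>P)"


section \<open>Submanifolds, tangent vectors and the Fisher metric\<close>

text \<open>
  The manifold structure of the family is the one of the global chart \<open>natural_coord \<mu>\<close>.
  Submanifolds are embedded submanifolds, given by local slice charts; differentiability class
  \<open>C\<^sup>1\<close> is all that is asked for, so smooth submanifolds are included.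
\<close>

definition C1_map_on :: "'a::real_normed_vector set \<Rightarrow> ('a \<Rightarrow> 'b::real_normed_vector) \<Rightarrow> bool" where
  "C1_map_on U f \<longleftrightarrow>
     (\<exists>f'. (\<forall>x\<in>U. (f has_derivative blinfun_apply (f' x)) (at x)) \<and> continuous_on U f')"

definition embedded_submanifold :: "'a::euclidean_space set \<Rightarrow> bool" where
  "embedded_submanifold X \<longleftrightarrow>
     (\<exists>L::'a set. subspace L \<and>
       (\<forall>x\<in>X. \<exists>U (V::'a set) \<phi> \<phi>'. open U \<and> x \<in> U \<and> open V \<and> homeomorphism U V \<phi> \<phi>' \<and>
          C1_map_on U \<phi> \<and> C1_map_on V \<phi>' \<and> \<phi> ` (X \<inter> U) = L \<inter> V))"

definition submanifold_of_family ::
  "((real^'v) \<times> (real^'h)) measure \<Rightarrow> ((real^'v) \<times> (real^'h)) measure set \<Rightarrow> bool" where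
  "submanifold_of_family \<mu> M \<longleftrightarrow>
     M \<subseteq> exp_family \<mu> \<and> embedded_submanifold (natural_coord \<mu> ` M)"

text \<open>
  Tangent vectors at \<open>Q\<close> to a set \<open>D\<close> of members of the family, expressed in natural coordinates:
  velocities at \<open>Q\<close> of \<open>C\<^sup>1\<close> curves running in \<open>D\<close>.
\<close>

definition tangent_vectors ::
  "((real^'v) \<times> (real^'h)) measure \<Rightarrow> ((real^'v) \<times> (real^'h)) measure set \<Rightarrow>
   ((real^'v) \<times> (real^'h)) measure \<Rightarrow> ((real^'v) \<times> (real^'h)) set" where
  "tangent_vectors \<mu> D Q =
     {u. \<exists>\<epsilon>>0. \<exists>\<gamma>. \<gamma> C1_differentiable_on {-\<epsilon><..<\<epsilon>} \<and>
           (\<forall>t\<in>{-\<epsilon><..<\<epsilon>}. \<gamma> t \<in> nat_param_space \<mu> \<and> expfam_dist \<mu> (\<gamma> t) \<in> D) \<and>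
           \<gamma> 0 = natural_coord \<mu> Q \<and> (\<gamma> has_vector_derivative u) (at 0)}"

text \<open>The score \<open>\<partial>\<^sub>u log p(r;\<theta>)\<close> and the Fisher metric
  \<open>g\<^sub>\<theta>(u,v) = E\<^sub>\<theta>[\<partial>\<^sub>u log p \<cdot> \<partial>\<^sub>v log p]\<close>.\<close>

definition score ::
  "((real^'v) \<times> (real^'h)) measure \<Rightarrow> (real^'v) \<times> (real^'h) \<Rightarrow> (real^'v) \<times> (real^'h) \<Rightarrow>
   (real^'v) \<times> (real^'h) \<Rightarrow> real" where
  "score \<mu> \<theta> u r = frechet_derivative (\<lambda>\<theta>'. ln (expfam_density \<mu> \<theta>' r)) (at \<theta>) u"

definition fisher_metric ::
  "((real^'v) \<times> (real^'h)) measure \<Rightarrow> (real^'v) \<times> (real^'h) \<Rightarrow> (real^'v) \<times> (real^'h) \<Rightarrow>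
   (real^'v) \<times> (real^'h) \<Rightarrow> real" where
  "fisher_metric \<mu> \<theta> u v = (\<integral>r. score \<mu> \<theta> u r * score \<mu> \<theta> v r \<partial>expfam_dist \<mu> \<theta>)"


section \<open>e-geodesics, e-projection and the data manifold\<close>

text \<open>The curve \<open>\<gamma>\<close> is the natural-coordinate expression of the e-geodesic from \<open>P\<close> to \<open>Q\<close>; the
  normalizing term is \<open>c t\<close>.\<close>

definition e_geodesic ::
  "((real^'v) \<times> (real^'h)) measure \<Rightarrow> ((real^'v) \<times> (real^'h)) measure \<Rightarrow>
   ((real^'v) \<times> (real^'h)) measure \<Rightarrow> (real \<Rightarrow> (real^'v) \<times> (real^'h)) \<Rightarrow> bool" where
  "e_geodesic \<mu> P Q \<gamma> \<longleftrightarrow>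
     (\<exists>c. \<forall>t\<in>{0..1}. \<gamma> t \<in> nat_param_space \<mu> \<and>
        (AE r in \<mu>. ln (expfam_density \<mu> (\<gamma> t) r) =
            (1 - t) * ln (expfam_density \<mu> (natural_coord \<mu> P) r)
            + t * ln (expfam_density \<mu> (natural_coord \<mu> Q) r) + c t))"

text \<open>The e-geodesic reaches \<open>Q\<close> at time \<open>1\<close>, so its velocity at \<open>Q\<close> is the one-sided derivative there.\<close>

definition is_e_projection ::
  "((real^'v) \<times> (real^'h)) measure \<Rightarrow> ((real^'v) \<times> (real^'h)) measure set \<Rightarrow>
   ((real^'v) \<times> (real^'h)) measure \<Rightarrow> ((real^'v) \<times> (real^'h)) measure \<Rightarrow> bool" where
  "is_e_projection \<mu> D P Q \<longleftrightarrow>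
     Q \<in> D \<and>
     (\<exists>\<gamma> w. e_geodesic \<mu> P Q \<gamma> \<and> (\<gamma> has_vector_derivative w) (at 1 within {0..1}) \<and>
        (\<forall>u \<in> tangent_vectors \<mu> D Q. fisher_metric \<mu> (natural_coord \<mu> Q) w u = 0))"

definition data_manifold ::
  "((real^'v) \<times> (real^'h)) measure \<Rightarrow> real^'v \<Rightarrow> ((real^'v) \<times> (real^'h)) measure set" where
  "data_manifold \<mu> rbar = {Q \<in> exp_family \<mu>. fst (expectation_coord Q) = rbar}"


section \<open>Conditioning the hidden variable on the visible one\<close>

definition visible_algebra :: "((real^'v) \<times> (real^'h)) measure" where
  "visible_algebra = vimage_algebra UNIV fst borel"

text \<open>\<open>\<kappa>\<close> is a (version of the) regular conditional distribution of \<open>r\<^sub>h\<close> given \<open>r\<^sub>\<nu>\<close> under \<open>P\<close>.\<close>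

definition is_cond_distr ::
  "((real^'v) \<times> (real^'h)) measure \<Rightarrow> (real^'v \<Rightarrow> (real^'h) measure) \<Rightarrow> bool" where
  "is_cond_distr P \<kappa> \<longleftrightarrow>
     \<kappa> \<in> borel \<rightarrow>\<^sub>M prob_algebra borel \<and>
     (\<forall>A\<in>sets borel. \<forall>B\<in>sets borel.
        emeasure P (A \<times> B) = (\<integral>\<^sup>+x\<in>A. emeasure (\<kappa> x) B \<partial>distr P borel fst))"

definition cond_prob_hidden ::
  "((real^'v) \<times> (real^'h)) measure \<Rightarrow> (real^'h) set \<Rightarrow> (real^'v) \<times> (real^'h) \<Rightarrow> real" where
  "cond_prob_hidden P B = real_cond_exp P visible_algebra (\<lambda>r. indicator B (snd r))"

definition cond_exp_hidden ::
  "((real^'v) \<times> (real^'h)) measure \<Rightarrow> (real^'v) \<times> (real^'h) \<Rightarrow> real^'h" where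
  "cond_exp_hidden P r = (\<chi> i. real_cond_exp P visible_algebra (\<lambda>r'. snd r' $ i) r)"

text \<open>
  Conditional objects are only determined up to null sets.  Equality of the conditional distributions
  means that \<open>P\<close> and \<open>Q\<close> have the same versions of the regular conditional distribution of \<open>r\<^sub>h\<close>
  given \<open>r\<^sub>\<nu>\<close>; the conditional probability of each event \<open>r\<^sub>h \<in> B\<close> is compared as well, so that the
  notion does not depend on the existence of regular versions.
\<close>

definition same_cond_distr ::
  "((real^'v) \<times> (real^'h)) measure \<Rightarrow> ((real^'v) \<times> (real^'h)) measure \<Rightarrow> bool" where
  "same_cond_distr P Q \<longleftrightarrow>
     (\<forall>\<kappa>. is_cond_distr P \<kappa> \<longleftrightarrow> is_cond_distr Q \<kappa>) \<and>
     (\<forall>B\<in>sets borel.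
        (AE r in P. cond_prob_hidden P B r = cond_prob_hidden Q B r) \<and>
        (AE r in Q. cond_prob_hidden P B r = cond_prob_hidden Q B r))"

definition same_cond_exp ::
  "((real^'v) \<times> (real^'h)) measure \<Rightarrow> ((real^'v) \<times> (real^'h)) measure \<Rightarrow> bool" where
  "same_cond_exp P Q \<longleftrightarrow>
     (AE r in P. cond_exp_hidden P r = cond_exp_hidden Q r) \<and>
     (AE r in Q. cond_exp_hidden P r = cond_exp_hidden Q r)"

end

theory Submission
  imports Defs
begin

text \<open>
  In the natural coordinates the derivative of the expectation coordinates is the Fisher metric, which
  is positive definite by minimality.  The inverse function theorem therefore lets one move the hidden
  expectation coordinates freely while the visible ones stay fixed, so the tangent vectors of the data
  manifold contain the Fisher dual of every \<open>(0, x)\<close>.  A velocity \<open>w\<close> orthogonal to all of them has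
  \<open>w\<^sub>h = 0\<close>, and the e-geodesic from \<open>P\<close> to \<open>Q\<close> has velocity \<open>\<theta>\<^sub>Q - \<theta>\<^sub>P\<close>.  When the hidden natural
  coordinates agree, the likelihood ratio of \<open>P\<close> and \<open>Q\<close> depends on the visible variable only, and
  reweighting by such a factor does not affect conditioning on that variable.
\<close>

section \<open>Elementary estimates\<close>

text \<open>Lagrange form of the second-order Maclaurin remainder. The intermediate point is at most
  \<open>\<bar>x\<bar>\<close> in absolute value, so \<open>exp \<bar>x\<bar>\<close> serves both
  signs of \<open>x\<close>.\<close>

lemma exp_remainder_bound: "\<bar>exp x - 1 - x\<bar> \<le> x\<^sup>2 / 2 * exp \<bar>x\<bar>" for x :: real
proof -
  obtain t where t: "\<bar>t\<bar> \<le> \<bar>x\<bar>" "exp x = (\<Sum>m<2. x ^ m / fact m) + exp t / fact 2 * x ^ 2"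
    using Maclaurin_exp_le[of x 2] by blast
  then have eq: "exp x - 1 - x = exp t / 2 * x\<^sup>2"
    by (simp add: numeral_2_eq_2)
  have "\<bar>exp x - 1 - x\<bar> = x\<^sup>2 / 2 * exp t"
    unfolding eq by (simp add: abs_mult)
  also have "\<dots> \<le> x\<^sup>2 / 2 * exp \<bar>x\<bar>"
    using t(1) by (intro mult_left_mono) auto
  finally show ?thesis .
qed

text \<open>The exponent \<open>\<delta> * norm r\<close> is spent in two halves: one bounds
  \<open>exp \<bar>h \<bullet> r\<bar>\<close>, the other the factor
  \<open>(norm r)\<^sup>2\<close>. What remains is quadratic in \<open>h\<close> times a function of
  \<open>r\<close> that does not involve \<open>h\<close>, as differentiation under the integral
  requires.\<close>

lemma exp_inner_remainder_bound:
  fixes h r :: "'a::real_inner"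
  assumes \<delta>: "\<delta> > 0" and h: "norm h \<le> \<delta>/2"
  shows "\<bar>exp (h \<bullet> r) - 1 - h \<bullet> r\<bar> \<le> ((norm h)\<^sup>2 * (2/\<delta>)\<^sup>2) * exp (\<delta> * norm r)"
proof -
  have hr: "\<bar>h \<bullet> r\<bar> \<le> norm h * norm r"
    by (rule Cauchy_Schwarz_ineq2)
  have "norm h * norm r \<le> \<delta>/2 * norm r"
    using h by (intro mult_right_mono) auto
  with hr have 1: "exp \<bar>h \<bullet> r\<bar> \<le> exp (\<delta>/2 * norm r)"
    by simp
  \<comment> \<open>For nonnegative \<open>y\<close>, the exponential dominates the quadratic term
    of its own series.\<close>
  have "(\<delta>/2 * norm r)\<^sup>2 / 2 \<le> exp (\<delta>/2 * norm r)"
  proof -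
    have pos: "0 \<le> \<delta>/2 * norm r"
      using \<delta> by simp
    show ?thesis
      using exp_lower_Taylor_quadratic[OF pos] pos by linarith
  qed
  then have "(2/\<delta>)\<^sup>2 * ((\<delta>/2 * norm r)\<^sup>2 / 2) \<le> (2/\<delta>)\<^sup>2 * exp (\<delta>/2 * norm r)"
    by (rule mult_left_mono) simp
  moreover have "(2/\<delta>)\<^sup>2 * ((\<delta>/2 * norm r)\<^sup>2 / 2) = (norm r)\<^sup>2 / 2"
    using \<delta> by (simp add: power2_eq_square)
  ultimately have 2: "(norm r)\<^sup>2 / 2 \<le> (2/\<delta>)\<^sup>2 * exp (\<delta>/2 * norm r)"
    by linarith
  have "(h \<bullet> r)\<^sup>2 \<le> (norm h * norm r)\<^sup>2"
    using hr by (simp add: abs_le_square_iff[symmetric])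
  then have "(h \<bullet> r)\<^sup>2 / 2 \<le> (norm h)\<^sup>2 * ((norm r)\<^sup>2 / 2)"
    by (simp add: power_mult_distrib)
  also have "\<dots> \<le> (norm h)\<^sup>2 * ((2/\<delta>)\<^sup>2 * exp (\<delta>/2 * norm r))"
    by (rule mult_left_mono[OF 2]) simp
  finally have 4: "(h \<bullet> r)\<^sup>2 / 2 * exp \<bar>h \<bullet> r\<bar> \<le>
      ((norm h)\<^sup>2 * ((2/\<delta>)\<^sup>2 * exp (\<delta>/2 * norm r))) * exp (\<delta>/2 * norm r)"
    using 1 by (intro mult_mono) auto
  have "\<bar>exp (h \<bullet> r) - 1 - h \<bullet> r\<bar> \<le> ((norm h)\<^sup>2 * ((2/\<delta>)\<^sup>2 * exp (\<delta>/2 * norm r))) * exp (\<delta>/2 * norm r)"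
    using exp_remainder_bound 4 by (rule order_trans)
  also have "\<dots> = ((norm h)\<^sup>2 * (2/\<delta>)\<^sup>2) * exp (\<delta> * norm r)"
    by (simp add: exp_add[symmetric])
  finally show ?thesis .
qed

text \<open>Pigeonhole on the bound of the norm by the sum of the absolute coordinates: some
  coordinate carries at least an average share.\<close>

lemma exists_Basis_norm_le:
  fixes x :: "'a::euclidean_space"
  shows "\<exists>b\<in>Basis. norm x \<le> real DIM('a) * \<bar>x \<bullet> b\<bar>"
proof (rule ccontr)
  assume "\<not> ?thesis"
  then have less: "\<And>b. b \<in> Basis \<Longrightarrow> \<bar>x \<bullet> b\<bar> < norm x / real DIM('a)"
    by (auto simp: field_simps not_le)
  have "(\<Sum>b\<in>Basis. \<bar>x \<bullet> b\<bar>) < (\<Sum>b\<in>(Basis::'a set). norm x / real DIM('a))"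
    by (rule sum_strict_mono) (auto simp: less)
  also have "\<dots> = norm x"
    by simp
  finally show False
    using norm_le_l1[of x] by simp
qed

text \<open>Trades the norm for finitely many linear functionals, so that exponential growth in the
  norm is controlled by shifting the natural parameter along the coordinate axes. The sign of the
  dominant coordinate is unknown, hence both shifts appear.\<close>

lemma exp_norm_le_sum_exp:
  fixes x :: "'a::euclidean_space"
  assumes "0 \<le> c"
  shows "exp (c / real DIM('a) * norm x) \<le> (\<Sum>b\<in>Basis. exp (c * (b \<bullet> x)) + exp (- c * (b \<bullet> x)))"
proof -
  obtain b where b: "b \<in> Basis" "norm x \<le> real DIM('a) * \<bar>x \<bullet> b\<bar>"
    using exists_Basis_norm_le by blast
  have "c / real DIM('a) * norm x \<le> c / real DIM('a) * (real DIM('a) * \<bar>x \<bullet> b\<bar>)"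
    by (rule mult_left_mono[OF b(2)]) (simp add: assms)
  also have "\<dots> = c * \<bar>b \<bullet> x\<bar>"
    by (simp add: inner_commute)
  finally have "exp (c / real DIM('a) * norm x) \<le> exp (c * \<bar>b \<bullet> x\<bar>)"
    by simp
  also have "\<dots> \<le> exp (c * (b \<bullet> x)) + exp (- c * (b \<bullet> x))"
    by (cases "b \<bullet> x \<ge> 0") (simp_all add: abs_if)
  also have "\<dots> \<le> (\<Sum>b\<in>Basis. exp (c * (b \<bullet> x)) + exp (- c * (b \<bullet> x)))"
    using b(1) by (intro member_le_sum) (auto intro: add_nonneg_nonneg)
  finally show ?thesis .
qed

section \<open>Continuity of the inverse of a linear map\<close>

text \<open>A lower bound \<open>c\<close> for the injective map \<open>G s\<close> survives, up to
  a factor \<open>1/2\<close>, for all nearby \<open>G t\<close>, which controls their inverses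
  uniformly. This later gives the continuous velocity of a curve obtained by local
  inversion.\<close>

lemma continuous_on_inv_blinfun_apply:
  fixes G :: "'b::topological_space \<Rightarrow> 'a::euclidean_space \<Rightarrow>\<^sub>L 'a"
  assumes G: "continuous_on T G" and bij: "\<And>t. t \<in> T \<Longrightarrow> bij (blinfun_apply (G t))"
  shows "continuous_on T (\<lambda>t. inv (blinfun_apply (G t)) d)"
  unfolding continuous_on_def
proof
  fix s assume s: "s \<in> T"
  let ?v = "\<lambda>t. inv (blinfun_apply (G t)) d"
  have Gv: "G t (?v t) = d" if "t \<in> T" for t
    using bij[OF that] by (simp add: bij_is_surj surj_f_inv_f)
  obtain c where c: "c > 0" "\<And>x. c * norm x \<le> norm (G s x)"
    using linear_inj_bounded_below_pos[of "blinfun_apply (G s)"] bij[OF s]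
    by (metis bij_is_inj bounded_linear.linear blinfun.bounded_linear_right mult.commute)
  have lim: "(G \<longlongrightarrow> G s) (at s within T)"
    using G s by (simp add: continuous_on_def)
  have near: "\<forall>\<^sub>F t in at s within T. norm (G t - G s) < c / 2"
    using tendstoD[OF lim, of "c/2"] c(1) by (simp add: dist_norm)
  have mem: "\<forall>\<^sub>F t in at s within T. t \<in> T"
    by (simp add: eventually_at_filter)
  have "\<forall>\<^sub>F t in at s within T. norm (?v t - ?v s) \<le> 2 / c * norm (d - G t (?v s))"
    using near mem
  proof eventually_elim
    case (elim t)
    have "c * norm (?v t - ?v s) \<le> norm (G s (?v t - ?v s))"
      by (rule c(2))
    \<comment> \<open>Writing \<open>G s\<close> as \<open>G t\<close> minus the perturbation
      isolates a residual that tends to zero; the perturbation term is absorbed into the left-hand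
      side.\<close>
    also have "G s (?v t - ?v s) = (d - G t (?v s)) - (G t - G s) (?v t - ?v s)"
      using Gv[OF elim(2)] by (simp add: blinfun.diff_left blinfun.diff_right)
    also have "norm \<dots> \<le> norm (d - G t (?v s)) + norm (G t - G s) * norm (?v t - ?v s)"
      by (rule order_trans[OF norm_triangle_ineq4 add_left_mono[OF norm_blinfun]])
    also have "\<dots> \<le> norm (d - G t (?v s)) + c / 2 * norm (?v t - ?v s)"
      using elim(1) by (intro add_left_mono mult_right_mono) auto
    finally show ?case
      using c(1) by (simp add: field_simps)
  qed
  then have "((\<lambda>t. ?v t - ?v s) \<longlongrightarrow> 0) (at s within T)"
  proof (rule Lim_null_comparison)
    have "((\<lambda>t. 2 / c * norm (d - G t (?v s))) \<longlongrightarrow> 2 / c * norm (d - G s (?v s))) (at s within T)"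
      by (intro tendsto_intros blinfun.tendsto lim)
    then show "((\<lambda>t. 2 / c * norm (d - G t (?v s))) \<longlongrightarrow> 0) (at s within T)"
      by (simp only: Gv[OF s] diff_self norm_zero mult_zero_right)
  qed
  then show "(?v \<longlongrightarrow> ?v s) (at s within T)"
    by (simp only: LIM_zero_iff)
qed

section \<open>Reweighting by a function of the visible variable\<close>

text \<open>A weight depending on the visible variable alone changes the joint law and the visible
  marginal by the same factor, so the kernel still disintegrates the weighted law.\<close>

lemma is_cond_distr_density_visible:
  fixes Q :: "((real^'v) \<times> (real^'h)) measure" and g :: "real^'v \<Rightarrow> ennreal"
  assumes sets_Q [measurable_cong]: "sets Q = sets borel" and [measurable]: "g \<in> borel_measurable borel"
    and \<kappa>: "is_cond_distr Q \<kappa>"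
  shows "is_cond_distr (density Q (\<lambda>r. g (fst r))) \<kappa>"
  unfolding is_cond_distr_def
proof (intro conjI ballI)
  show meas: "\<kappa> \<in> borel \<rightarrow>\<^sub>M prob_algebra borel"
    using \<kappa> by (simp add: is_cond_distr_def)
  note [measurable] = measurable_prob_algebraD[OF meas]
  have fst_Q [measurable]: "fst \<in> borel_measurable Q"
    unfolding measurable_cong_sets[OF sets_Q refl] by (intro borel_measurable_continuous_onI continuous_intros)
  fix A :: "(real^'v) set" and B :: "(real^'h) set"
  assume [measurable]: "A \<in> sets borel" "B \<in> sets borel"
  have rect [measurable]: "C \<times> B \<in> sets borel" if [measurable]: "C \<in> sets borel" for C :: "(real^'v) set"
    by (simp add: borel_prod[symmetric])
  \<comment> \<open>Restricting \<open>Q\<close> to the hidden event \<open>B\<close> and projecting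
    turns the disintegration identity into a density statement:
    \<open>emeasure (\<kappa> x) B\<close> is the density with respect to the visible marginal. Any
    nonnegative measurable function of the visible variable can then be integrated against
    it.\<close>
  let ?QB = "density Q (indicator (UNIV \<times> B))"
  have QB: "distr ?QB borel fst = density (distr Q borel fst) (\<lambda>x. emeasure (\<kappa> x) B)"
  proof (rule measure_eqI)
    fix C assume "C \<in> sets (distr ?QB borel fst)"
    then have [measurable]: "C \<in> sets borel"
      by simp
    have "emeasure (distr ?QB borel fst) C = (\<integral>\<^sup>+r. indicator (UNIV \<times> B) r * indicator (fst -` C) r \<partial>Q)"
      using measurable_sets[OF fst_Q, of C]
      by (simp add: emeasure_distr emeasure_density sets_eq_imp_space_eq[OF sets_Q] sets_Q)
    also have "\<dots> = (\<integral>\<^sup>+r. indicator (C \<times> B) r \<partial>Q)"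
      by (intro nn_integral_cong) (auto split: split_indicator)
    also have "\<dots> = (\<integral>\<^sup>+x\<in>C. emeasure (\<kappa> x) B \<partial>distr Q borel fst)"
      using \<kappa> by (simp add: is_cond_distr_def sets_Q)
    also have "\<dots> = emeasure (density (distr Q borel fst) (\<lambda>x. emeasure (\<kappa> x) B)) C"
      by (simp add: emeasure_density)
    finally show "emeasure (distr ?QB borel fst) C = emeasure (density (distr Q borel fst) (\<lambda>x. emeasure (\<kappa> x) B)) C" .
  qed simp
  have "emeasure (density Q (\<lambda>r. g (fst r))) (A \<times> B) = (\<integral>\<^sup>+r. g (fst r) * indicator (A \<times> B) r \<partial>Q)"
    by (simp add: emeasure_density sets_Q)
  also have "\<dots> = (\<integral>\<^sup>+r. indicator (UNIV \<times> B) r * (g (fst r) * indicator A (fst r)) \<partial>Q)"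
    by (intro nn_integral_cong) (auto split: split_indicator)
  also have "\<dots> = (\<integral>\<^sup>+r. g (fst r) * indicator A (fst r) \<partial>?QB)"
    by (subst nn_integral_density) auto
  also have "\<dots> = (\<integral>\<^sup>+x. g x * indicator A x \<partial>distr ?QB borel fst)"
    by (subst nn_integral_distr) auto
  also have "\<dots> = (\<integral>\<^sup>+x. emeasure (\<kappa> x) B * (g x * indicator A x) \<partial>distr Q borel fst)"
    unfolding QB by (subst nn_integral_density) auto
  also have "\<dots> = (\<integral>\<^sup>+x. g x * (emeasure (\<kappa> x) B * indicator A x) \<partial>distr Q borel fst)"
    by (simp add: mult_ac)
  also have "\<dots> = (\<integral>\<^sup>+x\<in>A. emeasure (\<kappa> x) B \<partial>density (distr Q borel fst) g)"
    by (subst nn_integral_density) auto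
  \<comment> \<open>The weight factors through \<open>fst\<close>, so weighting commutes with the
    projection.\<close>
  also have "density (distr Q borel fst) g = distr (density Q (\<lambda>r. g (fst r))) borel fst"
    by (rule density_distr) auto
  finally show "emeasure (density Q (\<lambda>r. g (fst r))) (A \<times> B) =
    (\<integral>\<^sup>+x\<in>A. emeasure (\<kappa> x) B \<partial>distr (density Q (\<lambda>r. g (fst r))) borel fst)" .
qed

lemma fst_measurable_visible_algebra [measurable]: "fst \<in> visible_algebra \<rightarrow>\<^sub>M borel"
  unfolding visible_algebra_def by (rule measurable_vimage_algebra1) simp

lemma finite_measure_subalgebra_visible:
  fixes Q :: "((real^'v) \<times> (real^'h)) measure"
  assumes "finite_measure Q" "sets Q = sets borel"
  shows "finite_measure_subalgebra Q visible_algebra"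
proof -
  have fst: "(fst :: (real^'v) \<times> (real^'h) \<Rightarrow> _) \<in> borel \<rightarrow>\<^sub>M borel"
    by (intro borel_measurable_continuous_onI continuous_intros)
  have "sets (visible_algebra :: ((real^'v) \<times> (real^'h)) measure) \<subseteq> sets borel"
    unfolding visible_algebra_def using measurable_sets[OF fst] by (auto simp: sets_vimage_algebra2)
  then have "subalgebra Q visible_algebra"
    using assms(2) sets_eq_imp_space_eq[OF assms(2)] by (simp add: subalgebra_def visible_algebra_def)
  then show ?thesis
    using assms(1) by (simp add: finite_measure_subalgebra_def finite_measure_subalgebra_axioms_def)
qed

text \<open>The weight is measurable for the conditioning algebra and can be pulled out of the
  conditional expectation. Hence the version computed under \<open>Q\<close> also satisfies the
  defining integral identity under \<open>P\<close>.\<close>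

lemma real_cond_exp_density_visible:
  fixes P Q :: "((real^'v) \<times> (real^'h)) measure" and g :: "real^'v \<Rightarrow> real"
  assumes P_eq: "P = density Q (\<lambda>r. ennreal (g (fst r)))"
    and sets_Q: "sets Q = sets borel" and finite: "finite_measure Q" "finite_measure P"
    and [measurable]: "g \<in> borel_measurable borel" and g: "\<And>x. 0 \<le> g x"
    and fQ: "integrable Q f" and fP: "integrable P f"
  shows "AE r in P. real_cond_exp P visible_algebra f r = real_cond_exp Q visible_algebra f r"
proof -
  have sets_P: "sets P = sets borel"
    by (simp add: P_eq sets_Q)
  interpret Q: finite_measure_subalgebra Q visible_algebra
    by (rule finite_measure_subalgebra_visible[OF finite(1) sets_Q])
  interpret P: finite_measure_subalgebra P visible_algebra
    by (rule finite_measure_subalgebra_visible[OF finite(2) sets_P])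
  have [measurable]: "f \<in> borel_measurable Q"
    using fQ by (rule borel_measurable_integrable)
  let ?E = "real_cond_exp Q visible_algebra f"
  have [measurable]: "?E \<in> borel_measurable Q"
    by (rule borel_measurable_cond_exp2)
  have gF [measurable]: "(\<lambda>r. g (fst r)) \<in> borel_measurable visible_algebra"
    by measurable
  have gQ [measurable]: "(\<lambda>r. g (fst r)) \<in> borel_measurable Q"
    by (rule measurable_from_subalg[OF Q.subalg gF])
  have integrable_P: "integrable P h \<longleftrightarrow> integrable Q (\<lambda>r. g (fst r) * h r)"
    if "h \<in> borel_measurable Q" for h :: "_ \<Rightarrow> real"
    unfolding P_eq using that g gQ by (intro integrable_real_density) auto
  have gf: "integrable Q (\<lambda>r. g (fst r) * f r)"
    using fP by (simp add: integrable_P)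
  show ?thesis
  proof (rule P.real_cond_exp_charact)
    show "integrable P f"
      by (rule fP)
    show "integrable P ?E"
      using Q.real_cond_exp_intg(1)[OF gf gF] by (simp add: integrable_P)
    show "?E \<in> borel_measurable visible_algebra"
      by (rule borel_measurable_cond_exp)
    fix A assume A [measurable]: "A \<in> sets (visible_algebra :: ((real^'v) \<times> (real^'h)) measure)"
    then have AQ [measurable]: "A \<in> sets Q"
      using Q.subalg by (auto simp: subalgebra_def)
    have dens: "(\<integral>r\<in>A. h r \<partial>P) = (\<integral>r. (g (fst r) * indicator A r) * h r \<partial>Q)"
      if [measurable]: "h \<in> borel_measurable Q" for h :: "(real^'v) \<times> (real^'h) \<Rightarrow> real"
    proof -
      have "(\<integral>r\<in>A. h r \<partial>P) = (\<integral>r. g (fst r) * (indicator A r * h r) \<partial>Q)"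
        unfolding P_eq set_lebesgue_integral_def real_scaleR_def using g
        by (intro integral_real_density) auto
      then show ?thesis
        by (simp add: mult.assoc)
    qed
    \<comment> \<open>The weight times the indicator of \<open>A\<close> is a single visible test
      function, to which the pull-out property under \<open>Q\<close> applies.\<close>
    have "integrable Q (\<lambda>r. (g (fst r) * indicator A r) * f r)"
      using integrable_mult_indicator[OF AQ gf] by (simp add: mult_ac)
    from Q.real_cond_exp_intg(2)[OF this]
    show "(\<integral>r\<in>A. f r \<partial>P) = (\<integral>r\<in>A. ?E r \<partial>P)"
      by (simp add: dens)
  qed
qed

section \<open>Moments of an exponential family\<close>

locale exp_family_model =
  fixes \<mu> :: "((real^'v) \<times> (real^'h)) measure"
  assumes family: "regular_minimal_exp_family \<mu>"
begin

abbreviation "\<Theta> \<equiv> nat_param_space \<mu>"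

lemma sets_base [simp, measurable_cong]: "sets \<mu> = sets borel"
  and open_Theta: "open \<Theta>"
  and minimal: "(AE r in \<mu>. c \<bullet> r = d) \<Longrightarrow> c = 0"
  using family unfolding regular_minimal_exp_family_def by blast+

section \<open>Integrability and differentiation under the integral sign\<close>

text \<open>Integrability is demanded at all parameters at once: together with openness of the
  parameter space this makes the class stable under multiplication by linear functionals, that is,
  under differentiation.\<close>

definition exp_integrable :: "((real^'v) \<times> (real^'h) \<Rightarrow> real) \<Rightarrow> bool" where
  "exp_integrable f \<longleftrightarrow>
     f \<in> borel_measurable borel \<and> (\<forall>\<theta>\<in>\<Theta>. integrable \<mu> (\<lambda>r. f r * exp (\<theta> \<bullet> r)))"

text \<open>The Laplace transform of \<open>f\<close> times the base measure, left unnormalized; for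
  \<open>f = 1\<close> it is the partition function.\<close>

definition moment :: "((real^'v) \<times> (real^'h) \<Rightarrow> real) \<Rightarrow> (real^'v) \<times> (real^'h) \<Rightarrow> real" where
  "moment f \<theta> = (\<integral>r. f r * exp (\<theta> \<bullet> r) \<partial>\<mu>)"

lemma exp_integrable_measurable: "exp_integrable f \<Longrightarrow> f \<in> borel_measurable borel"
  by (simp add: exp_integrable_def)

lemma exp_integrableD: "exp_integrable f \<Longrightarrow> \<theta> \<in> \<Theta> \<Longrightarrow> integrable \<mu> (\<lambda>r. f r * exp (\<theta> \<bullet> r))"
  by (simp add: exp_integrable_def)

lemma exp_integrable_const: "exp_integrable (\<lambda>_. c)"
  by (simp add: exp_integrable_def nat_param_space_def)

text \<open>Since the parameter space is open, a factor \<open>exp (\<delta> * norm r)\<close> can be absorbed for small \<open>\<delta>\<close>; it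
  dominates the polynomial factors produced by differentiating.\<close>

lemma exp_integrable_exp_norm:
  assumes f: "exp_integrable f" and \<theta>: "\<theta> \<in> \<Theta>"
  obtains \<delta> where "\<delta> > 0" "integrable \<mu> (\<lambda>r. \<bar>f r\<bar> * exp (\<theta> \<bullet> r) * exp (\<delta> * norm r))"
proof -
  have [measurable]: "f \<in> borel_measurable borel"
    by (rule exp_integrable_measurable[OF f])
  obtain e where e: "e > 0" "ball \<theta> e \<subseteq> \<Theta>"
    using open_Theta \<theta> open_contains_ball by blast
  define n where "n = DIM((real^'v) \<times> (real^'h))"
  \<comment> \<open>Shifts of length \<open>e/2\<close> stay inside the ball of radius
    \<open>e\<close>; dividing by the dimension matches the bound of the norm by
    coordinates.\<close>
  define \<delta> where "\<delta> = (e/2) / real n"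
  have mem: "\<theta> + (e/2) *\<^sub>R b \<in> \<Theta>" "\<theta> - (e/2) *\<^sub>R b \<in> \<Theta>" if "b \<in> Basis" for b
    using e that by (auto intro!: subsetD[OF e(2)] simp: dist_norm)
  have int: "integrable \<mu> (\<lambda>r. \<Sum>b\<in>Basis. \<bar>f r * exp ((\<theta> + (e/2) *\<^sub>R b) \<bullet> r)\<bar> + \<bar>f r * exp ((\<theta> - (e/2) *\<^sub>R b) \<bullet> r)\<bar>)"
    by (intro Bochner_Integration.integrable_sum Bochner_Integration.integrable_add integrable_abs exp_integrableD[OF f] mem)
  have "integrable \<mu> (\<lambda>r. \<bar>f r\<bar> * exp (\<theta> \<bullet> r) * exp (\<delta> * norm r))"
  proof (rule Bochner_Integration.integrable_bound[OF int])
    show "AE r in \<mu>. norm (\<bar>f r\<bar> * exp (\<theta> \<bullet> r) * exp (\<delta> * norm r)) \<le>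
      norm (\<Sum>b\<in>Basis. \<bar>f r * exp ((\<theta> + (e/2) *\<^sub>R b) \<bullet> r)\<bar> + \<bar>f r * exp ((\<theta> - (e/2) *\<^sub>R b) \<bullet> r)\<bar>)"
    proof (rule AE_I2)
      fix r :: "(real^'v) \<times> (real^'h)"
      have "\<bar>f r\<bar> * exp (\<theta> \<bullet> r) * exp (\<delta> * norm r) \<le>
        \<bar>f r\<bar> * exp (\<theta> \<bullet> r) * (\<Sum>b\<in>Basis. exp ((e/2) * (b \<bullet> r)) + exp (- (e/2) * (b \<bullet> r)))"
        using exp_norm_le_sum_exp[of "e/2" r] e(1) unfolding \<delta>_def n_def
        by (intro mult_left_mono) auto
      also have "\<dots> = (\<Sum>b\<in>Basis. \<bar>f r * exp ((\<theta> + (e/2) *\<^sub>R b) \<bullet> r)\<bar> + \<bar>f r * exp ((\<theta> - (e/2) *\<^sub>R b) \<bullet> r)\<bar>)"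
        unfolding sum_distrib_left
      proof (rule sum.cong)
        fix b :: "(real^'v) \<times> (real^'h)"
        show "\<bar>f r\<bar> * exp (\<theta> \<bullet> r) * (exp ((e/2) * (b \<bullet> r)) + exp (- (e/2) * (b \<bullet> r))) =
          \<bar>f r * exp ((\<theta> + (e/2) *\<^sub>R b) \<bullet> r)\<bar> + \<bar>f r * exp ((\<theta> - (e/2) *\<^sub>R b) \<bullet> r)\<bar>"
          by (simp only: abs_mult abs_exp_cancel inner_add_left inner_diff_left inner_scaleR_left
              diff_conv_add_uminus exp_add distrib_left mult_minus_left inner_minus_left mult.assoc)
      qed simp
      also have "\<dots> \<le> norm \<dots>"
        by simp
      finally show "norm (\<bar>f r\<bar> * exp (\<theta> \<bullet> r) * exp (\<delta> * norm r)) \<le>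
        norm (\<Sum>b\<in>Basis. \<bar>f r * exp ((\<theta> + (e/2) *\<^sub>R b) \<bullet> r)\<bar> + \<bar>f r * exp ((\<theta> - (e/2) *\<^sub>R b) \<bullet> r)\<bar>)"
        by (simp add: abs_mult)
    qed
  qed measurable
  moreover have "\<delta> > 0"
    using e(1) DIM_positive[where 'a="(real^'v) \<times> (real^'h)"] unfolding \<delta>_def n_def
    by (intro divide_pos_pos) (auto simp del: DIM_prod)
  ultimately show ?thesis
    using that by blast
qed

text \<open>Linear growth is absorbed by \<open>exp (\<delta> * norm r)\<close>, because
  \<open>y \<le> exp y\<close>. Iterating gives the second moments.\<close>

lemma exp_integrable_mult_inner:
  assumes f: "exp_integrable f"
  shows "exp_integrable (\<lambda>r. f r * (h \<bullet> r))"
  unfolding exp_integrable_def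
proof (intro conjI ballI)
  have [measurable]: "f \<in> borel_measurable borel"
    by (rule exp_integrable_measurable[OF f])
  show "(\<lambda>r. f r * (h \<bullet> r)) \<in> borel_measurable borel"
    by measurable
  fix \<theta> assume "\<theta> \<in> \<Theta>"
  then obtain \<delta> where \<delta>: "\<delta> > 0" "integrable \<mu> (\<lambda>r. \<bar>f r\<bar> * exp (\<theta> \<bullet> r) * exp (\<delta> * norm r))"
    using exp_integrable_exp_norm[OF f] by blast
  show "integrable \<mu> (\<lambda>r. f r * (h \<bullet> r) * exp (\<theta> \<bullet> r))"
  proof (rule Bochner_Integration.integrable_bound[OF integrable_mult_left[OF \<delta>(2), of "norm h / \<delta>"]])
    show "AE r in \<mu>. norm (f r * (h \<bullet> r) * exp (\<theta> \<bullet> r)) \<le>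
        norm (\<bar>f r\<bar> * exp (\<theta> \<bullet> r) * exp (\<delta> * norm r) * (norm h / \<delta>))"
    proof (rule AE_I2)
      fix r :: "(real^'v) \<times> (real^'h)"
      have "\<delta> * norm r \<le> exp (\<delta> * norm r)"
        using exp_ge_add_one_self[of "\<delta> * norm r"] by linarith
      then have "norm r \<le> exp (\<delta> * norm r) / \<delta>"
        using \<delta>(1) by (simp add: field_simps)
      then have "\<bar>h \<bullet> r\<bar> \<le> norm h * (exp (\<delta> * norm r) / \<delta>)"
        by (meson Cauchy_Schwarz_ineq2 mult_left_mono norm_ge_zero order_trans)
      then have "\<bar>f r\<bar> * exp (\<theta> \<bullet> r) * \<bar>h \<bullet> r\<bar> \<le> \<bar>f r\<bar> * exp (\<theta> \<bullet> r) * (norm h * (exp (\<delta> * norm r) / \<delta>))"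
        by (intro mult_left_mono) auto
      then show "norm (f r * (h \<bullet> r) * exp (\<theta> \<bullet> r)) \<le>
        norm (\<bar>f r\<bar> * exp (\<theta> \<bullet> r) * exp (\<delta> * norm r) * (norm h / \<delta>))"
        using \<delta>(1) by (simp add: abs_mult algebra_simps)
    qed
  qed measurable
qed

lemma exp_integrable_inner: "exp_integrable (\<lambda>r. h \<bullet> r)"
  using exp_integrable_mult_inner[OF exp_integrable_const, of 1 h] by simp

text \<open>The remainder of the exponential is quadratic in \<open>h\<close> with an integrable
  dominating function. The derivative is again a moment, of a function in the same class.\<close>

lemma has_derivative_moment:
  assumes f: "exp_integrable f" and \<theta>: "\<theta> \<in> \<Theta>"
  shows "(moment f has_derivative (\<lambda>h. moment (\<lambda>r. f r * (h \<bullet> r)) \<theta>)) (at \<theta>)"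
  unfolding has_derivative_at
proof
  have fh: "integrable \<mu> (\<lambda>r. f r * (h \<bullet> r) * exp (\<theta> \<bullet> r))" for h
    by (rule exp_integrableD[OF exp_integrable_mult_inner[OF f] \<theta>])
  have "linear (\<lambda>h. moment (\<lambda>r. f r * (h \<bullet> r)) \<theta>)"
  proof (rule linearI)
    fix a b :: "(real^'v) \<times> (real^'h)" and c :: real
    show "moment (\<lambda>r. f r * ((a + b) \<bullet> r)) \<theta> = moment (\<lambda>r. f r * (a \<bullet> r)) \<theta> + moment (\<lambda>r. f r * (b \<bullet> r)) \<theta>"
      unfolding moment_def Bochner_Integration.integral_add[OF fh fh, symmetric]
      by (rule Bochner_Integration.integral_cong) (auto simp: inner_add_left algebra_simps)
    have "moment (\<lambda>r. f r * ((c *\<^sub>R a) \<bullet> r)) \<theta> = (\<integral>r. c * (f r * (a \<bullet> r) * exp (\<theta> \<bullet> r)) \<partial>\<mu>)"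
      unfolding moment_def by (rule Bochner_Integration.integral_cong) auto
    then show "moment (\<lambda>r. f r * ((c *\<^sub>R a) \<bullet> r)) \<theta> = c *\<^sub>R moment (\<lambda>r. f r * (a \<bullet> r)) \<theta>"
      by (simp add: moment_def)
  qed
  then show "bounded_linear (\<lambda>h. moment (\<lambda>r. f r * (h \<bullet> r)) \<theta>)"
    by (simp add: linear_conv_bounded_linear)
  have [measurable]: "f \<in> borel_measurable borel"
    by (rule exp_integrable_measurable[OF f])
  obtain \<delta> where \<delta>: "\<delta> > 0" "integrable \<mu> (\<lambda>r. \<bar>f r\<bar> * exp (\<theta> \<bullet> r) * exp (\<delta> * norm r))"
    using exp_integrable_exp_norm[OF f \<theta>] by blast
  obtain e where e: "e > 0" "ball \<theta> e \<subseteq> \<Theta>"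
    using open_Theta \<theta> open_contains_ball by blast
  define K where "K = (2/\<delta>)\<^sup>2 * (\<integral>r. \<bar>f r\<bar> * exp (\<theta> \<bullet> r) * exp (\<delta> * norm r) \<partial>\<mu>)"
  let ?R = "\<lambda>h. moment f (\<theta> + h) - moment f \<theta> - moment (\<lambda>r. f r * (h \<bullet> r)) \<theta>"
  \<comment> \<open>The radius \<open>e\<close> keeps \<open>\<theta> + h\<close> in the parameter
    space; \<open>\<delta>/2\<close> is the range of the pointwise remainder bound.\<close>
  have bound: "norm (?R h) \<le> (norm h)\<^sup>2 * K" if h: "norm h < min e (\<delta>/2)" for h
  proof -
    have \<theta>h: "\<theta> + h \<in> \<Theta>"
      using h by (intro subsetD[OF e(2)]) (simp add: dist_norm)
    note ints = exp_integrableD[OF f \<theta>h] exp_integrableD[OF f \<theta>] fh[of h]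
    let ?g = "\<lambda>r. f r * exp ((\<theta> + h) \<bullet> r) - f r * exp (\<theta> \<bullet> r) - f r * (h \<bullet> r) * exp (\<theta> \<bullet> r)"
    have "norm (?R h) = norm (\<integral>r. ?g r \<partial>\<mu>)"
      using ints by (simp add: moment_def)
    also have "\<dots> \<le> (\<integral>r. norm (?g r) \<partial>\<mu>)"
      by (rule integral_norm_bound)
    also have "\<dots> \<le> (\<integral>r. ((norm h)\<^sup>2 * (2/\<delta>)\<^sup>2) * (\<bar>f r\<bar> * exp (\<theta> \<bullet> r) * exp (\<delta> * norm r)) \<partial>\<mu>)"
    proof (rule integral_mono)
      show "integrable \<mu> (\<lambda>r. norm (?g r))"
        using ints by (intro integrable_norm Bochner_Integration.integrable_diff)
      show "integrable \<mu> (\<lambda>r. ((norm h)\<^sup>2 * (2/\<delta>)\<^sup>2) * (\<bar>f r\<bar> * exp (\<theta> \<bullet> r) * exp (\<delta> * norm r)))"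
        by (intro integrable_mult_right \<delta>(2))
      fix r :: "(real^'v) \<times> (real^'h)"
      have "\<bar>exp (h \<bullet> r) - 1 - h \<bullet> r\<bar> \<le> ((norm h)\<^sup>2 * (2/\<delta>)\<^sup>2) * exp (\<delta> * norm r)"
        using h by (intro exp_inner_remainder_bound \<delta>(1)) simp
      then have "\<bar>f r\<bar> * exp (\<theta> \<bullet> r) * \<bar>exp (h \<bullet> r) - 1 - h \<bullet> r\<bar> \<le>
          \<bar>f r\<bar> * exp (\<theta> \<bullet> r) * (((norm h)\<^sup>2 * (2/\<delta>)\<^sup>2) * exp (\<delta> * norm r))"
        by (rule mult_left_mono) auto
      moreover have "?g r = f r * exp (\<theta> \<bullet> r) * (exp (h \<bullet> r) - 1 - h \<bullet> r)"
        by (simp add: inner_add_left exp_add algebra_simps)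
      ultimately show "norm (?g r) \<le> ((norm h)\<^sup>2 * (2/\<delta>)\<^sup>2) * (\<bar>f r\<bar> * exp (\<theta> \<bullet> r) * exp (\<delta> * norm r))"
        by (simp add: abs_mult mult_ac)
    qed
    also have "\<dots> = (norm h)\<^sup>2 * K"
      by (simp add: K_def)
    finally show ?thesis .
  qed
  show "(\<lambda>h. norm (?R h) / norm h) \<midarrow>0\<rightarrow> 0"
  proof (rule Lim_null_comparison)
    have "\<forall>\<^sub>F h in at 0. norm (h::(real^'v) \<times> (real^'h)) < min e (\<delta>/2)"
      using e(1) \<delta>(1) by (auto simp: eventually_at intro!: exI[of _ "min e (\<delta>/2)"])
    then show "\<forall>\<^sub>F h in at 0. norm (norm (?R h) / norm h) \<le> norm h * K"
    proof eventually_elim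
      case (elim h)
      then show ?case
        using bound[of h] by (cases "h = 0") (auto simp: field_simps power2_eq_square)
    qed
    show "(\<lambda>h. norm h * K) \<midarrow>0\<rightarrow> 0"
      by (auto intro!: tendsto_eq_intros)
  qed
qed

section \<open>Normalization, densities and expectations\<close>

text \<open>For the zero measure every linear functional would vanish almost everywhere,
  contradicting minimality because the space has a nonzero vector.\<close>

lemma not_AE_False: "\<not> (AE r in \<mu>. False)"
proof
  assume "AE r in \<mu>. False"
  then have "AE r in \<mu>. c \<bullet> r = 0" for c
    by eventually_elim simp
  then have "c = 0" for c :: "(real^'v) \<times> (real^'h)"
    using minimal by blast
  then show False
    using nonzero_Basis SOME_Basis by blast
qed

text \<open>A strictly positive integrand has zero integral only for the zero measure.\<close>

lemma moment_one_pos: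
  assumes "\<theta> \<in> \<Theta>"
  shows "0 < moment (\<lambda>_. 1) \<theta>"
proof -
  have int: "integrable \<mu> (\<lambda>r. 1 * exp (\<theta> \<bullet> r))"
    by (rule exp_integrableD[OF exp_integrable_const assms])
  have "moment (\<lambda>_. 1) \<theta> \<noteq> 0"
    using integral_nonneg_eq_0_iff_AE[OF int] not_AE_False by (auto simp: moment_def)
  moreover have "0 \<le> moment (\<lambda>_. 1) \<theta>"
    by (simp add: moment_def)
  ultimately show ?thesis
    by simp
qed

lemma log_normalizer_eq: "log_normalizer \<mu> \<theta> = ln (moment (\<lambda>_. 1) \<theta>)"
  by (simp add: log_normalizer_def moment_def)

lemma expfam_density_eq:
  "\<theta> \<in> \<Theta> \<Longrightarrow> expfam_density \<mu> \<theta> r = exp (\<theta> \<bullet> r) / moment (\<lambda>_. 1) \<theta>"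
  by (simp add: expfam_density_def log_normalizer_eq exp_diff moment_one_pos)

lemma expfam_density_measurable [measurable]: "expfam_density \<mu> \<theta> \<in> borel_measurable borel"
  unfolding expfam_density_def[abs_def] by measurable

lemma expfam_density_pos: "0 < expfam_density \<mu> \<theta> r"
  by (simp add: expfam_density_def)

lemma sets_expfam_dist [simp, measurable_cong]: "sets (expfam_dist \<mu> \<theta>) = sets borel"
  by (simp add: expfam_dist_def)

lemma space_expfam_dist [simp]: "space (expfam_dist \<mu> \<theta>) = UNIV"
  using sets_eq_imp_space_eq[OF sets_expfam_dist] by simp

text \<open>The densities are strictly positive, so all members of the family have the null sets of
  the base measure.\<close>

lemma AE_expfam_dist_iff: "(AE r in expfam_dist \<mu> \<theta>. A r) \<longleftrightarrow> (AE r in \<mu>. A r)"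
  unfolding expfam_dist_def by (subst AE_density) (auto simp: expfam_density_pos)

text \<open>The expectation under the member at \<open>\<theta>\<close>, written as a quotient of
  moments so that it can be differentiated in \<open>\<theta>\<close>.\<close>

definition expect :: "((real^'v) \<times> (real^'h) \<Rightarrow> real) \<Rightarrow> (real^'v) \<times> (real^'h) \<Rightarrow> real" where
  "expect f \<theta> = moment f \<theta> / moment (\<lambda>_. 1) \<theta>"

lemma integrable_expfam_dist:
  assumes f: "exp_integrable f" and \<theta>: "\<theta> \<in> \<Theta>"
  shows "integrable (expfam_dist \<mu> \<theta>) f"
proof -
  have [measurable]: "f \<in> borel_measurable borel"
    by (rule exp_integrable_measurable[OF f])
  show ?thesis
    using integrable_divide[OF exp_integrableD[OF f \<theta>], of "moment (\<lambda>_. 1) \<theta>"] unfolding expfam_dist_def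
    by (subst integrable_real_density)
      (auto simp: expfam_density_eq[OF \<theta>] moment_one_pos[OF \<theta>, THEN less_imp_le] mult.commute)
qed

lemma integral_expfam_dist:
  assumes f: "exp_integrable f" and \<theta>: "\<theta> \<in> \<Theta>"
  shows "(\<integral>r. f r \<partial>expfam_dist \<mu> \<theta>) = expect f \<theta>"
proof -
  have [measurable]: "f \<in> borel_measurable borel"
    by (rule exp_integrable_measurable[OF f])
  have "(\<integral>r. f r \<partial>expfam_dist \<mu> \<theta>) = (\<integral>r. f r * exp (\<theta> \<bullet> r) / moment (\<lambda>_. 1) \<theta> \<partial>\<mu>)"
    unfolding expfam_dist_def
    by (subst integral_real_density)
      (auto simp: expfam_density_eq[OF \<theta>] moment_one_pos[OF \<theta>, THEN less_imp_le] mult.commute)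
  then show ?thesis
    by (simp add: expect_def moment_def)
qed

lemma prob_space_expfam_dist:
  assumes "\<theta> \<in> \<Theta>"
  shows "prob_space (expfam_dist \<mu> \<theta>)"
proof -
  have int: "integrable \<mu> (\<lambda>r. 1 * exp (\<theta> \<bullet> r) / moment (\<lambda>_. 1) \<theta>)"
    by (rule integrable_divide[OF exp_integrableD[OF exp_integrable_const assms]])
  have "emeasure (expfam_dist \<mu> \<theta>) UNIV = (\<integral>\<^sup>+r. ennreal (1 * exp (\<theta> \<bullet> r) / moment (\<lambda>_. 1) \<theta>) \<partial>\<mu>)"
    unfolding expfam_dist_def by (subst emeasure_density) (simp_all add: expfam_density_eq[OF assms])
  also have "\<dots> = ennreal (\<integral>r. 1 * exp (\<theta> \<bullet> r) / moment (\<lambda>_. 1) \<theta> \<partial>\<mu>)"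
    using moment_one_pos[OF assms] by (intro nn_integral_eq_integral[OF int]) simp
  also have "(\<integral>r. 1 * exp (\<theta> \<bullet> r) / moment (\<lambda>_. 1) \<theta> \<partial>\<mu>) = 1"
    using moment_one_pos[OF assms] by (simp add: moment_def)
  finally show ?thesis
    by (intro prob_spaceI) simp
qed

text \<open>By the quotient rule, the derivative in direction \<open>h\<close> is the covariance of
  \<open>f r\<close> and \<open>h \<bullet> r\<close>.\<close>

lemma has_derivative_expect:
  assumes f: "exp_integrable f" and \<theta>: "\<theta> \<in> \<Theta>"
  shows "(expect f has_derivative
    (\<lambda>h. expect (\<lambda>r. f r * (h \<bullet> r)) \<theta> - expect f \<theta> * expect (\<lambda>r. h \<bullet> r) \<theta>)) (at \<theta>)"
proof -
  have pos: "moment (\<lambda>_. 1) \<theta> \<noteq> 0"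
    using moment_one_pos[OF \<theta>] by simp
  show ?thesis
    unfolding expect_def[abs_def]
    by (rule has_derivative_eq_rhs[OF has_derivative_divide'[OF has_derivative_moment[OF f \<theta>]
            has_derivative_moment[OF exp_integrable_const \<theta>] pos]])
      (use pos in \<open>auto simp: field_simps\<close>)
qed

lemma continuous_on_expect: "exp_integrable f \<Longrightarrow> continuous_on \<Theta> (expect f)"
  by (meson continuous_at_imp_continuous_on has_derivative_continuous has_derivative_expect)

lemma has_derivative_log_normalizer:
  assumes \<theta>: "\<theta> \<in> \<Theta>"
  shows "(log_normalizer \<mu> has_derivative (\<lambda>h. expect (\<lambda>r. h \<bullet> r) \<theta>)) (at \<theta>)"
  unfolding log_normalizer_eq[abs_def]
  by (rule has_derivative_eq_rhs[OF has_derivative_ln[OF moment_one_pos[OF \<theta>]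
          has_derivative_moment[OF exp_integrable_const \<theta>]]])
    (auto simp: expect_def field_simps)

subsection \<open>The Fisher metric and the expectation coordinates\<close>

lemma score_eq:
  assumes \<theta>: "\<theta> \<in> \<Theta>"
  shows "score \<mu> \<theta> u r = u \<bullet> r - expect (\<lambda>r. u \<bullet> r) \<theta>"
proof -
  have "((\<lambda>\<theta>'. ln (expfam_density \<mu> \<theta>' r)) has_derivative (\<lambda>u. u \<bullet> r - expect (\<lambda>r. u \<bullet> r) \<theta>)) (at \<theta>)"
    unfolding expfam_density_def ln_exp
    by (intro derivative_intros has_derivative_log_normalizer[OF \<theta>])
  then show ?thesis
    by (simp add: score_def frechet_derivative_at[symmetric])
qed

text \<open>The score is the centered linear statistic, so the metric is the covariance form of
  \<open>r\<close>.\<close>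

lemma fisher_metric_eq:
  assumes \<theta>: "\<theta> \<in> \<Theta>"
  shows "fisher_metric \<mu> \<theta> u v =
    expect (\<lambda>r. (u \<bullet> r) * (v \<bullet> r)) \<theta> - expect (\<lambda>r. u \<bullet> r) \<theta> * expect (\<lambda>r. v \<bullet> r) \<theta>"
proof -
  interpret prob_space "expfam_dist \<mu> \<theta>"
    by (rule prob_space_expfam_dist[OF \<theta>])
  let ?m = "\<lambda>u. expect (\<lambda>r. u \<bullet> r) \<theta>"
  note 1 = exp_integrable_inner
  note 2 = exp_integrable_mult_inner[OF exp_integrable_inner]
  note [simp] = integrable_expfam_dist[OF 1 \<theta>] integrable_expfam_dist[OF 2 \<theta>]
  have "fisher_metric \<mu> \<theta> u v =
      (\<integral>r. (u \<bullet> r) * (v \<bullet> r) - ?m v * (u \<bullet> r) - ?m u * (v \<bullet> r) + ?m u * ?m v \<partial>expfam_dist \<mu> \<theta>)"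
    unfolding fisher_metric_def score_eq[OF \<theta>]
    by (rule Bochner_Integration.integral_cong) (auto simp: algebra_simps)
  also have "\<dots> = expect (\<lambda>r. (u \<bullet> r) * (v \<bullet> r)) \<theta> - ?m v * ?m u - ?m u * ?m v + ?m u * ?m v"
    using prob_space by (simp add: integral_expfam_dist[OF 1 \<theta>] integral_expfam_dist[OF 2 \<theta>])
  finally show ?thesis
    by simp
qed

lemma fisher_metric_commute: "fisher_metric \<mu> \<theta> u v = fisher_metric \<mu> \<theta> v u"
  by (simp add: fisher_metric_def mult.commute)

text \<open>Zero variance makes \<open>u \<bullet> r\<close> almost everywhere constant, which
  minimality excludes for nonzero \<open>u\<close>.\<close>

lemma fisher_metric_definite:
  assumes \<theta>: "\<theta> \<in> \<Theta>" and zero: "fisher_metric \<mu> \<theta> u u = 0"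
  shows "u = 0"
proof -
  interpret prob_space "expfam_dist \<mu> \<theta>"
    by (rule prob_space_expfam_dist[OF \<theta>])
  let ?m = "expect (\<lambda>r. u \<bullet> r) \<theta>"
  note [simp] = integrable_expfam_dist[OF exp_integrable_inner \<theta>]
    integrable_expfam_dist[OF exp_integrable_mult_inner[OF exp_integrable_inner] \<theta>]
  have "integrable (expfam_dist \<mu> \<theta>) (\<lambda>r. (u \<bullet> r) * (u \<bullet> r) - 2 * ?m * (u \<bullet> r) + ?m * ?m)"
    by simp
  then have int: "integrable (expfam_dist \<mu> \<theta>) (\<lambda>r. score \<mu> \<theta> u r * score \<mu> \<theta> u r)"
    by (simp add: score_eq[OF \<theta>] algebra_simps)
  have "AE r in expfam_dist \<mu> \<theta>. score \<mu> \<theta> u r * score \<mu> \<theta> u r = 0"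
    using integral_nonneg_eq_0_iff_AE[OF int] zero by (simp add: fisher_metric_def)
  then have "AE r in \<mu>. u \<bullet> r = ?m"
    by (simp add: AE_expfam_dist_iff score_eq[OF \<theta>])
  then show ?thesis
    by (rule minimal)
qed

section \<open>The expectation map and its Jacobian\<close>

definition \<eta> :: "(real^'v) \<times> (real^'h) \<Rightarrow> (real^'v) \<times> (real^'h)" where
  "\<eta> \<theta> = (\<integral>r. r \<partial>expfam_dist \<mu> \<theta>)"

lemma integrable_ident:
  assumes \<theta>: "\<theta> \<in> \<Theta>"
  shows "integrable (expfam_dist \<mu> \<theta>) (\<lambda>r. r)"
proof -
  have "integrable (expfam_dist \<mu> \<theta>) (\<lambda>r. \<Sum>b\<in>Basis. (b \<bullet> r) *\<^sub>R b)"
    by (intro Bochner_Integration.integrable_sum integrable_scaleR_left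
        integrable_expfam_dist[OF exp_integrable_inner \<theta>])
  then show ?thesis
    by (simp add: inner_commute euclidean_representation)
qed

lemma expectation_coord_expfam_dist: "\<theta> \<in> \<Theta> \<Longrightarrow> expectation_coord (expfam_dist \<mu> \<theta>) = \<eta> \<theta>"
  by (simp add: expectation_coord_def \<eta>_def prod_eq_iff integrable_ident
      integral_bounded_linear[OF bounded_linear_fst] integral_bounded_linear[OF bounded_linear_snd])

lemma inner_\<eta>: "\<theta> \<in> \<Theta> \<Longrightarrow> \<eta> \<theta> \<bullet> u = expect (\<lambda>r. u \<bullet> r) \<theta>"
  using integral_expfam_dist[OF exp_integrable_inner, of \<theta> u]
  by (simp add: \<eta>_def integrable_ident integral_inner_left[symmetric] inner_commute)

text \<open>Both sides are the same covariance: the Fisher metric is the Jacobian of the expectation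
  coordinates.\<close>

lemma has_derivative_expect_inner:
  assumes \<theta>: "\<theta> \<in> \<Theta>"
  shows "(expect (\<lambda>r. u \<bullet> r) has_derivative fisher_metric \<mu> \<theta> u) (at \<theta>)"
proof -
  have "fisher_metric \<mu> \<theta> u =
    (\<lambda>h. expect (\<lambda>r. (u \<bullet> r) * (h \<bullet> r)) \<theta> - expect (\<lambda>r. u \<bullet> r) \<theta> * expect (\<lambda>r. h \<bullet> r) \<theta>)"
    by (rule ext) (rule fisher_metric_eq[OF \<theta>])
  then show ?thesis
    using has_derivative_expect[OF exp_integrable_inner \<theta>, of u] by simp
qed

text \<open>The Fisher information matrix, packaged as a bounded linear map because the inverse
  function theorem takes its derivatives in that form.\<close>

definition fisher_operator :: "(real^'v) \<times> (real^'h) \<Rightarrow> (((real^'v) \<times> (real^'h)) \<Rightarrow>\<^sub>L ((real^'v) \<times> (real^'h)))" where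
  "fisher_operator \<theta> = Blinfun (\<lambda>u. \<Sum>b\<in>Basis. fisher_metric \<mu> \<theta> b u *\<^sub>R b)"

lemma has_derivative_\<eta>:
  assumes \<theta>: "\<theta> \<in> \<Theta>"
  shows "(\<eta> has_derivative fisher_operator \<theta>) (at \<theta>)"
    and fisher_operator_apply: "fisher_operator \<theta> u = (\<Sum>b\<in>Basis. fisher_metric \<mu> \<theta> b u *\<^sub>R b)"
proof -
  have der: "(\<eta> has_derivative (\<lambda>u. \<Sum>b\<in>Basis. fisher_metric \<mu> \<theta> b u *\<^sub>R b)) (at \<theta>)"
    unfolding has_derivative_componentwise_within[of \<eta>]
  proof
    fix b :: "(real^'v) \<times> (real^'h)" assume "b \<in> Basis"
    then have 1: "(\<Sum>c\<in>Basis. fisher_metric \<mu> \<theta> c u *\<^sub>R c) \<bullet> b = fisher_metric \<mu> \<theta> b u" for u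
      by (rule inner_sum_left_Basis)
    show "((\<lambda>\<theta>. \<eta> \<theta> \<bullet> b) has_derivative (\<lambda>u. (\<Sum>c\<in>Basis. fisher_metric \<mu> \<theta> c u *\<^sub>R c) \<bullet> b)) (at \<theta>)"
      unfolding 1 by (rule has_derivative_transform_within_open[OF has_derivative_expect_inner[OF \<theta>] open_Theta \<theta>]) (simp add: inner_\<eta>)
  qed
  \<comment> \<open>Being a derivative supplies the bounded linearity that makes
    \<open>Blinfun\<close> transparent.\<close>
  note eq = bounded_linear_Blinfun_apply[OF has_derivative_bounded_linear[OF der]]
  show "(\<eta> has_derivative fisher_operator \<theta>) (at \<theta>)"
    unfolding fisher_operator_def eq by (rule der)
  show "fisher_operator \<theta> u = (\<Sum>b\<in>Basis. fisher_metric \<mu> \<theta> b u *\<^sub>R b)"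
    unfolding fisher_operator_def eq ..
qed

text \<open>Turns orthogonality for the Fisher metric into Euclidean orthogonality to the image
  under the operator.\<close>

lemma inner_fisher_operator:
  assumes \<theta>: "\<theta> \<in> \<Theta>"
  shows "fisher_operator \<theta> u \<bullet> v = fisher_metric \<mu> \<theta> v u"
proof -
  have "linear (\<lambda>v. fisher_metric \<mu> \<theta> v u)"
    unfolding fisher_metric_commute[of _ _ u]
    using has_derivative_linear[OF has_derivative_expect_inner[OF \<theta>]] by simp
  from linear_sum[OF this, of "\<lambda>b. (v \<bullet> b) *\<^sub>R b" Basis]
  have "fisher_metric \<mu> \<theta> v u = (\<Sum>b\<in>Basis. (v \<bullet> b) * fisher_metric \<mu> \<theta> b u)"
    by (simp only: euclidean_representation linear_cmul[OF \<open>linear _\<close>] real_scaleR_def)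
  then show ?thesis
    by (simp add: fisher_operator_apply[OF \<theta>] inner_sum_left inner_commute[of v] mult.commute)
qed

text \<open>Definiteness makes the kernel trivial, and in finite dimension injectivity gives
  surjectivity.\<close>

lemma bij_fisher_operator:
  assumes \<theta>: "\<theta> \<in> \<Theta>"
  shows "bij (fisher_operator \<theta>)"
proof -
  have lin: "linear (fisher_operator \<theta>)"
    by (simp add: bounded_linear.linear blinfun.bounded_linear_right)
  have "u = 0" if "fisher_operator \<theta> u = 0" for u
    using inner_fisher_operator[OF \<theta>, of u u] that fisher_metric_definite[OF \<theta>] by simp
  then have "inj (fisher_operator \<theta>)"
    using linear_injective_0[OF lin] by blast
  then show ?thesis
    using linear_injective_imp_surjective[OF lin] by (simp add: bij_def)
qed

lemma continuous_on_fisher_operator: "continuous_on \<Theta> fisher_operator"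
proof (rule continuous_on_blinfun_componentwise)
  fix i :: "(real^'v) \<times> (real^'h)" assume "i \<in> Basis"
  have "continuous_on \<Theta> (\<lambda>\<theta>. fisher_metric \<mu> \<theta> b i)" for b
    by (rule continuous_on_eq[OF _ fisher_metric_eq[symmetric]])
      (intro continuous_intros continuous_on_expect exp_integrable_mult_inner exp_integrable_inner)
  then have "continuous_on \<Theta> (\<lambda>\<theta>. \<Sum>b\<in>Basis. fisher_metric \<mu> \<theta> b i *\<^sub>R b)"
    by (intro continuous_intros)
  then show "continuous_on \<Theta> (\<lambda>\<theta>. fisher_operator \<theta> i)"
    by (rule continuous_on_eq) (simp add: fisher_operator_apply)
qed

text \<open>The curve is the straight line through \<open>\<eta> \<theta>\<close> in direction
  \<open>d\<close>, pulled back by the local inverse of \<open>\<eta>\<close>.\<close>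

lemma exists_curve_with_expectation_line:
  assumes \<theta>: "\<theta> \<in> \<Theta>"
  obtains \<epsilon> \<gamma> where "\<epsilon> > 0" "\<gamma> C1_differentiable_on {-\<epsilon><..<\<epsilon>}" "\<gamma> 0 = \<theta>"
    "\<And>t. t \<in> {-\<epsilon><..<\<epsilon>} \<Longrightarrow> \<gamma> t \<in> \<Theta> \<and> \<eta> (\<gamma> t) = \<eta> \<theta> + t *\<^sub>R d"
    "(\<gamma> has_vector_derivative inv (fisher_operator \<theta>) d) (at 0)"
proof -
  have "linear (fisher_operator \<theta>)"
    by (simp add: bounded_linear.linear blinfun.bounded_linear_right)
  then obtain k where k: "linear k" "k \<circ> fisher_operator \<theta> = id"
    using linear_injective_left_inverse bij_fisher_operator[OF \<theta>] by (metis bij_is_inj)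
  have "Blinfun k o\<^sub>L fisher_operator \<theta> = id_blinfun"
    using pointfree_idE[OF k(2)] k(1)
    by (intro blinfun_eqI) (simp add: bounded_linear_Blinfun_apply linear_conv_bounded_linear[symmetric])
  from inverse_function_theorem[OF open_Theta has_derivative_\<eta>(1) continuous_on_fisher_operator \<theta> this]
  obtain U V g g' where inverse: "open U" "U \<subseteq> \<Theta>" "\<theta> \<in> U" "open V" "\<eta> \<theta> \<in> V" "homeomorphism U V \<eta> g"
    "\<And>y. y \<in> V \<Longrightarrow> (g has_derivative g' y) (at y)"
    "\<And>y. y \<in> V \<Longrightarrow> g' y = inv (fisher_operator (g y))"
    by metis
  obtain e where e: "e > 0" "ball (\<eta> \<theta>) e \<subseteq> V"
    using inverse(4,5) open_contains_ball by blast
  \<comment> \<open>Keeps the line inside the ball of radius \<open>e\<close>; the summand 1 covers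
    \<open>d = 0\<close>.\<close>
  define \<epsilon> where "\<epsilon> = e / (norm d + 1)"
  define \<gamma> where "\<gamma> t = g (\<eta> \<theta> + t *\<^sub>R d)" for t
  have "norm d + 1 > 0"
    by (simp add: add_nonneg_pos)
  then have \<epsilon>: "\<epsilon> > 0"
    using e(1) by (simp add: \<epsilon>_def)
  have V: "\<eta> \<theta> + t *\<^sub>R d \<in> V" if "t \<in> {-\<epsilon><..<\<epsilon>}" for t
  proof -
    have "\<bar>t\<bar> * norm d \<le> \<bar>t\<bar> * (norm d + 1)"
      by (rule mult_left_mono) auto
    also have "\<dots> < \<epsilon> * (norm d + 1)"
      using that \<open>norm d + 1 > 0\<close> by (intro mult_strict_right_mono) auto
    also have "\<dots> = e"
      using \<open>norm d + 1 > 0\<close> by (simp add: \<epsilon>_def)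
    finally show ?thesis
      by (intro subsetD[OF e(2)]) (simp add: dist_norm)
  qed
  have \<gamma>U: "\<gamma> t \<in> U" "\<eta> (\<gamma> t) = \<eta> \<theta> + t *\<^sub>R d" if "t \<in> {-\<epsilon><..<\<epsilon>}" for t
    using inverse(6) V[OF that] unfolding homeomorphism_def \<gamma>_def by blast+
  have \<gamma>0: "\<gamma> 0 = \<theta>"
    using inverse(3,6) by (simp add: \<gamma>_def homeomorphism_apply1)
  have der: "(\<gamma> has_vector_derivative inv (fisher_operator (\<gamma> t)) d) (at t)" if t: "t \<in> {-\<epsilon><..<\<epsilon>}" for t
  proof -
    have "((\<lambda>t. \<eta> \<theta> + t *\<^sub>R d) has_derivative (\<lambda>t. t *\<^sub>R d)) (at t)"
      by (auto intro!: derivative_eq_intros)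
    from has_derivative_compose[OF this inverse(7)[OF V[OF t]]]
    have "(\<gamma> has_derivative (\<lambda>s. g' (\<eta> \<theta> + t *\<^sub>R d) (s *\<^sub>R d))) (at t)"
      by (simp add: \<gamma>_def[abs_def])
    moreover have "g' (\<eta> \<theta> + t *\<^sub>R d) (s *\<^sub>R d) = s *\<^sub>R g' (\<eta> \<theta> + t *\<^sub>R d) d" for s
      using inverse(7)[OF V[OF t]] by (simp add: has_derivative_linear linear_cmul)
    ultimately show ?thesis
      using inverse(8)[OF V[OF t]] by (simp add: has_vector_derivative_def \<gamma>_def)
  qed
  have "continuous_on {-\<epsilon><..<\<epsilon>} \<gamma>"
    using der by (meson continuous_at_imp_continuous_on has_vector_derivative_continuous)
  then have "continuous_on {-\<epsilon><..<\<epsilon>} (\<lambda>t. fisher_operator (\<gamma> t))"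
    using \<gamma>U(1) inverse(2) by (intro continuous_on_compose2[OF continuous_on_fisher_operator]) auto
  \<comment> \<open>The velocity is the inverse Fisher operator at the moving point, so its
    continuity is that of inversion.\<close>
  then have "continuous_on {-\<epsilon><..<\<epsilon>} (\<lambda>t. inv (fisher_operator (\<gamma> t)) d)"
    using \<gamma>U(1) inverse(2) by (intro continuous_on_inv_blinfun_apply bij_fisher_operator) auto
  then have "\<gamma> C1_differentiable_on {-\<epsilon><..<\<epsilon>}"
    unfolding C1_differentiable_on_def
    by (intro exI[of _ "\<lambda>t. inv (fisher_operator (\<gamma> t)) d"] conjI ballI der)
  moreover have "(\<gamma> has_vector_derivative inv (fisher_operator \<theta>) d) (at 0)"
    using der[of 0] \<epsilon> \<gamma>0 by simp
  moreover have "\<gamma> t \<in> \<Theta> \<and> \<eta> (\<gamma> t) = \<eta> \<theta> + t *\<^sub>R d" if "t \<in> {-\<epsilon><..<\<epsilon>}" for t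
    using \<gamma>U[OF that] inverse(2) by blast
  ultimately show ?thesis
    using that \<epsilon> \<gamma>0 by blast
qed

subsection \<open>The e-projection\<close>

text \<open>Minimality in the form of comparing slopes: it identifies parameters from log densities
  known up to additive constants.\<close>

lemma affine_relation_unique:
  assumes "AE r in \<mu>. c \<bullet> r + k = c' \<bullet> r + k'"
  shows "c = c'"
proof -
  have "AE r in \<mu>. (c - c') \<bullet> r = k' - k"
    using assms by eventually_elim (simp add: inner_diff_left)
  from minimal[OF this] show ?thesis
    by simp
qed

text \<open>Equal measures of finite mass have almost everywhere equal densities, whose logarithms
  are affine in \<open>r\<close> with slope the natural parameter.\<close>

lemma expfam_dist_inject:
  assumes \<theta>: "\<theta> \<in> \<Theta>" "\<theta>' \<in> \<Theta>" and eq: "expfam_dist \<mu> \<theta> = expfam_dist \<mu> \<theta>'"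
  shows "\<theta> = \<theta>'"
proof -
  have "(\<integral>\<^sup>+r. ennreal (expfam_density \<mu> \<theta> r) \<partial>\<mu>) = emeasure (expfam_dist \<mu> \<theta>) UNIV"
    unfolding expfam_dist_def by (subst emeasure_density) simp_all
  also have "\<dots> = 1"
    using prob_space.emeasure_space_1[OF prob_space_expfam_dist[OF \<theta>(1)]] by simp
  finally have "AE r in \<mu>. ennreal (expfam_density \<mu> \<theta> r) = ennreal (expfam_density \<mu> \<theta>' r)"
    using eq unfolding expfam_dist_def by (subst (asm) finite_density_unique) simp_all
  then have "AE r in \<mu>. \<theta> \<bullet> r + (- log_normalizer \<mu> \<theta>) = \<theta>' \<bullet> r + (- log_normalizer \<mu> \<theta>')"
    by eventually_elim (simp add: expfam_density_def)
  then show ?thesis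
    by (rule affine_relation_unique)
qed

lemma natural_coord_expfam_dist: "\<theta> \<in> \<Theta> \<Longrightarrow> natural_coord \<mu> (expfam_dist \<mu> \<theta>) = \<theta>"
  unfolding natural_coord_def by (rule the_equality) (simp, metis expfam_dist_inject)

text \<open>Compare slopes in \<open>r\<close> in the defining equation; the normalizing term and
  the log-normalizers enter only the constants.\<close>

lemma e_geodesic_straight:
  assumes \<theta>: "\<theta> \<in> \<Theta>" "\<theta>' \<in> \<Theta>"
    and geo: "e_geodesic \<mu> (expfam_dist \<mu> \<theta>) (expfam_dist \<mu> \<theta>') \<gamma>" and t: "t \<in> {0..1}"
  shows "\<gamma> t = (1 - t) *\<^sub>R \<theta> + t *\<^sub>R \<theta>'"
proof -
  let ?\<psi> = "log_normalizer \<mu>"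
  obtain c where "AE r in \<mu>. ln (expfam_density \<mu> (\<gamma> t) r) =
      (1 - t) * ln (expfam_density \<mu> \<theta> r) + t * ln (expfam_density \<mu> \<theta>' r) + c t"
    using geo t unfolding e_geodesic_def natural_coord_expfam_dist[OF \<theta>(1)] natural_coord_expfam_dist[OF \<theta>(2)]
    by blast
  then have "AE r in \<mu>. \<gamma> t \<bullet> r + (- ?\<psi> (\<gamma> t)) =
      ((1 - t) *\<^sub>R \<theta> + t *\<^sub>R \<theta>') \<bullet> r + (c t - (1 - t) * ?\<psi> \<theta> - t * ?\<psi> \<theta>')"
    by eventually_elim (simp add: expfam_density_def inner_add_left algebra_simps)
  then show ?thesis
    by (rule affine_relation_unique)
qed

text \<open>A direction \<open>d\<close> without visible part leaves the visible expectation fixed,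
  so the curve over that line runs in the data manifold.\<close>

lemma tangent_vectors_data_manifold:
  assumes \<theta>: "\<theta> \<in> \<Theta>" and D: "fst (\<eta> \<theta>) = rbar" and d: "fst d = 0"
  shows "inv (fisher_operator \<theta>) d \<in> tangent_vectors \<mu> (data_manifold \<mu> rbar) (expfam_dist \<mu> \<theta>)"
proof -
  obtain \<epsilon> \<gamma> where \<gamma>: "\<epsilon> > 0" "\<gamma> C1_differentiable_on {-\<epsilon><..<\<epsilon>}" "\<gamma> 0 = \<theta>"
    "\<And>t. t \<in> {-\<epsilon><..<\<epsilon>} \<Longrightarrow> \<gamma> t \<in> \<Theta> \<and> \<eta> (\<gamma> t) = \<eta> \<theta> + t *\<^sub>R d"
    "(\<gamma> has_vector_derivative inv (fisher_operator \<theta>) d) (at 0)"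
    using exists_curve_with_expectation_line[OF \<theta>, of d] by metis
  have "\<gamma> t \<in> \<Theta> \<and> expfam_dist \<mu> (\<gamma> t) \<in> data_manifold \<mu> rbar" if "t \<in> {-\<epsilon><..<\<epsilon>}" for t
    using \<gamma>(4)[OF that] D d by (simp add: data_manifold_def exp_family_def expectation_coord_expfam_dist)
  then show ?thesis
    unfolding tangent_vectors_def natural_coord_expfam_dist[OF \<theta>] using \<gamma>(1-3,5) by blast
qed

lemma e_projection_hidden_coord:
  assumes \<theta>: "\<theta> \<in> \<Theta>" "\<theta>' \<in> \<Theta>"
    and proj: "is_e_projection \<mu> (data_manifold \<mu> rbar) (expfam_dist \<mu> \<theta>) (expfam_dist \<mu> \<theta>')"
  shows "snd \<theta>' = snd \<theta>"
proof -
  obtain \<gamma> w where geo: "e_geodesic \<mu> (expfam_dist \<mu> \<theta>) (expfam_dist \<mu> \<theta>') \<gamma>"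
    and w: "(\<gamma> has_vector_derivative w) (at 1 within {0..1})"
    and orth: "\<And>u. u \<in> tangent_vectors \<mu> (data_manifold \<mu> rbar) (expfam_dist \<mu> \<theta>') \<Longrightarrow> fisher_metric \<mu> \<theta>' w u = 0"
    and mem: "expfam_dist \<mu> \<theta>' \<in> data_manifold \<mu> rbar"
    using proj unfolding is_e_projection_def natural_coord_expfam_dist[OF \<theta>(2)] by blast
  have "((\<lambda>t. (1 - t) *\<^sub>R \<theta> + t *\<^sub>R \<theta>') has_vector_derivative \<theta>' - \<theta>) (at 1 within {0..1})"
    by (auto intro!: derivative_eq_intros)
  then have "(\<gamma> has_vector_derivative \<theta>' - \<theta>) (at 1 within {0..1})"
    by (rule has_vector_derivative_transform[rotated 2]) (use e_geodesic_straight[OF \<theta> geo] in auto)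
  \<comment> \<open>The geodesic is determined on \<open>{0..1}\<close> only, hence uniqueness of
    the one-sided derivative at the endpoint.\<close>
  then have w_eq: "w = \<theta>' - \<theta>"
    using w by (intro vector_derivative_unique_within_closed_interval[of 0 1 1 \<gamma>]) (auto simp: cbox_interval)
  \<comment> \<open>Testing with the hidden part of \<open>w\<close> itself: orthogonality to the
    Fisher dual of this vector becomes the vanishing of the squared norm of
    \<open>snd w\<close>.\<close>
  let ?d = "(0, snd w) :: (real^'v) \<times> (real^'h)"
  let ?u = "inv (fisher_operator \<theta>') ?d"
  have "fst (\<eta> \<theta>') = rbar"
    using mem by (simp add: data_manifold_def expectation_coord_expfam_dist[OF \<theta>(2)])
  then have "fisher_metric \<mu> \<theta>' w ?u = 0"
    by (intro orth tangent_vectors_data_manifold \<theta>) simp_all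
  then have "fisher_operator \<theta>' ?u \<bullet> w = 0"
    by (simp add: inner_fisher_operator[OF \<theta>(2)])
  then have "?d \<bullet> w = 0"
    by (simp only: surj_f_inv_f[OF bij_is_surj[OF bij_fisher_operator[OF \<theta>(2)]]])
  then have "snd w = 0"
    by (simp add: inner_prod_def)
  then show ?thesis
    by (simp add: w_eq)
qed

subsection \<open>Members with equal hidden natural coordinates\<close>

text \<open>The hidden terms of the two exponents cancel in the likelihood ratio, leaving a function
  of the visible variable.\<close>

lemma expfam_dist_density_visible:
  assumes hidden: "snd \<theta> = snd \<theta>'"
  shows "expfam_dist \<mu> \<theta> = density (expfam_dist \<mu> \<theta>')
    (\<lambda>r. ennreal (exp ((fst \<theta> - fst \<theta>') \<bullet> fst r - (log_normalizer \<mu> \<theta> - log_normalizer \<mu> \<theta>'))))"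
    (is "_ = density _ (\<lambda>r. ennreal (?g (fst r)))")
proof -
  have [measurable]: "(\<lambda>r::(real^'v) \<times> (real^'h). ?g (fst r)) \<in> borel_measurable borel"
    by (intro borel_measurable_continuous_onI continuous_intros)
  have "expfam_density \<mu> \<theta> r = expfam_density \<mu> \<theta>' r * ?g (fst r)" for r
    using hidden by (simp add: expfam_density_def inner_prod_def inner_diff_left exp_add[symmetric])
  then have "ennreal (expfam_density \<mu> \<theta> r) = ennreal (expfam_density \<mu> \<theta>' r) * ennreal (?g (fst r))" for r
    by (simp add: ennreal_mult[symmetric] expfam_density_pos less_imp_le)
  then show ?thesis
    unfolding expfam_dist_def by (subst density_density_eq) simp_all
qed

lemma is_cond_distr_expfam_dist:
  assumes "snd \<theta> = snd \<theta>'" "is_cond_distr (expfam_dist \<mu> \<theta>') \<kappa>"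
  shows "is_cond_distr (expfam_dist \<mu> \<theta>) \<kappa>"
  unfolding expfam_dist_density_visible[OF assms(1)]
  by (rule is_cond_distr_density_visible[OF sets_expfam_dist _ assms(2)]) measurable

text \<open>Stated for the base measure, whose null sets are those of both members; this covers the
  two almost-everywhere claims at once.\<close>

lemma real_cond_exp_expfam_dist:
  assumes \<theta>: "\<theta> \<in> \<Theta>" "\<theta>' \<in> \<Theta>" and hidden: "snd \<theta> = snd \<theta>'" and f: "exp_integrable f"
  shows "AE r in \<mu>. real_cond_exp (expfam_dist \<mu> \<theta>) visible_algebra f r =
    real_cond_exp (expfam_dist \<mu> \<theta>') visible_algebra f r"
  unfolding AE_expfam_dist_iff[where \<theta> = \<theta>, symmetric]
  by (rule real_cond_exp_density_visible[OF expfam_dist_density_visible[OF hidden] sets_expfam_dist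
        prob_space.finite_measure[OF prob_space_expfam_dist[OF \<theta>(2)]]
        prob_space.finite_measure[OF prob_space_expfam_dist[OF \<theta>(1)]] _ _
        integrable_expfam_dist[OF f \<theta>(2)] integrable_expfam_dist[OF f \<theta>(1)]]) simp_all

text \<open>A factor bounded by 1 preserves integrability of the exponential.\<close>

lemma exp_integrable_indicator_snd:
  assumes [measurable]: "B \<in> sets borel"
  shows "exp_integrable (\<lambda>r. indicator B (snd r))"
  unfolding exp_integrable_def
proof (intro conjI ballI)
  have "snd \<in> borel_measurable (borel :: ((real^'v) \<times> (real^'h)) measure)"
    by (intro borel_measurable_continuous_onI continuous_intros)
  then show meas: "(\<lambda>r::(real^'v) \<times> (real^'h). indicator B (snd r) :: real) \<in> borel_measurable borel"
    by measurable
  fix \<theta> assume "\<theta> \<in> \<Theta>"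
  then have "integrable \<mu> (\<lambda>r. exp (\<theta> \<bullet> r))"
    by (simp add: nat_param_space_def)
  then show "integrable \<mu> (\<lambda>r. indicator B (snd r) * exp (\<theta> \<bullet> r))"
    by (rule Bochner_Integration.integrable_bound) (use meas in \<open>auto split: split_indicator\<close>)
qed

lemma exp_integrable_snd_component: "exp_integrable (\<lambda>r. snd r $ i)"
  using exp_integrable_inner[of "(0, axis i 1)"] by (simp add: inner_prod_def inner_axis inner_commute)

lemma same_cond_distr_expfam_dist:
  assumes "\<theta> \<in> \<Theta>" "\<theta>' \<in> \<Theta>" "snd \<theta> = snd \<theta>'"
  shows "same_cond_distr (expfam_dist \<mu> \<theta>) (expfam_dist \<mu> \<theta>')"
  unfolding same_cond_distr_def AE_expfam_dist_iff cond_prob_hidden_def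
  using is_cond_distr_expfam_dist[of \<theta> \<theta>'] is_cond_distr_expfam_dist[of \<theta>' \<theta>] assms
    real_cond_exp_expfam_dist[OF assms exp_integrable_indicator_snd]
  by auto

text \<open>Equality of vectors is equality of finitely many coordinates, so the exceptional null
  sets can be united.\<close>

lemma same_cond_exp_expfam_dist:
  assumes "\<theta> \<in> \<Theta>" "\<theta>' \<in> \<Theta>" "snd \<theta> = snd \<theta>'"
  shows "same_cond_exp (expfam_dist \<mu> \<theta>) (expfam_dist \<mu> \<theta>')"
  unfolding same_cond_exp_def AE_expfam_dist_iff cond_exp_hidden_def vec_eq_iff
  by (intro conjI; simp; intro eventually_all_finite real_cond_exp_expfam_dist[OF assms exp_integrable_snd_component])

end

theorem theorem5p4:
  fixes \<mu> P Qs :: "((real^'v) \<times> (real^'h)) measure"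
    and M :: "((real^'v) \<times> (real^'h)) measure set"
    and rbar \<theta>P\<^sub>\<nu> \<theta>Q\<^sub>\<nu> :: "real^'v"
    and \<theta>P\<^sub>h \<theta>Q\<^sub>h \<eta>Q\<^sub>h :: "real^'h"
  assumes "regular_minimal_exp_family \<mu>"
    and "submanifold_of_family \<mu> M"
    and "P \<in> M"
    and "natural_coord \<mu> P = (\<theta>P\<^sub>\<nu>, \<theta>P\<^sub>h)"
    and "Qs \<in> data_manifold \<mu> rbar"
    and "natural_coord \<mu> Qs = (\<theta>Q\<^sub>\<nu>, \<theta>Q\<^sub>h)"
    and "expectation_coord Qs = (rbar, \<eta>Q\<^sub>h)"
    and "is_e_projection \<mu> (data_manifold \<mu> rbar) P Qs"
  shows "\<theta>Q\<^sub>h = \<theta>P\<^sub>h \<and> same_cond_distr P Qs \<and> same_cond_exp P Qs"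
proof -
  interpret exp_family_model \<mu>
    by unfold_locales fact
  have "P \<in> exp_family \<mu>" "Qs \<in> exp_family \<mu>"
    using assms(2,3,5) by (auto simp: submanifold_of_family_def data_manifold_def)
  then obtain \<theta> \<theta>' where \<theta>: "\<theta> \<in> \<Theta>" "P = expfam_dist \<mu> \<theta>" and \<theta>': "\<theta>' \<in> \<Theta>" "Qs = expfam_dist \<mu> \<theta>'"
    by (auto simp: exp_family_def)
  \<comment> \<open>Uniqueness of natural coordinates identifies the given ones with the chosen
    parameters.\<close>
  have coords: "snd \<theta> = \<theta>P\<^sub>h" "snd \<theta>' = \<theta>Q\<^sub>h"
    using assms(4,6) \<theta> \<theta>' by (simp_all add: natural_coord_expfam_dist)
  have hidden: "snd \<theta>' = snd \<theta>"
    using assms(8) \<theta> \<theta>' by (intro e_projection_hidden_coord) simp_all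
  then show ?thesis
    using \<theta> \<theta>' coords same_cond_distr_expfam_dist same_cond_exp_expfam_dist by simp
qed

end
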